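(* In the real-time communication system described in the context, $\pi_t$ and $\varphi_t$ are the information states for the encoder and the memory update respectively, i.e.: 1. there is a linear transformation $Q_t(c_t)$ such that $$\varphi_t = Q_t(c_t)\,\pi_t ;$$ 2. there is a linear transformation $\widehat Q_t(l_t)$ such that $$\pi_{t+1} = \widehat Q_t(l_t)\,\varphi_t ;$$ 3. for any choice of $c$ and $l$, the expected conditional instantaneous cost can be expressed as $$\mathbb E\{\rho_t(X_t,\widehat X_t)\mid c^t,\,g_t^*(c^t,l^{t-1}),\,l^{t-1}\}=\tilde\rho_t(\varphi_t),$$ where $g_t^*(c^t,l^{t-1})$ is an optimal decoding rule corresponding to $c^t,l^{t-1}$ and $\tilde\rho_t(\cdot)$ is a deterministic function.
   Context: System. $\mathcal X,\mathcal Z,\mathcal Y,\mathcal M$ are finite sets, $\mathcal M=\{1,\dots,|\mathcal M|\}$, and $T$ is a finite horizon. For sequences, $x^t=(x_1,\dots,x_t)$, and similarly for random variables and functions. $X_1,\dots,X_T$ is a first-order Markov source on $\mathcal X$ with known law of $X_1$ and known transition probabilities $P_{X_{t+1}|X_t}$. At each stage $t$ the encoder sends a symbol $Z_t\in\mathcal Z$, generated from $X_1,\dots,X_t$, through a discrete memoryless channel with output $Y_t\in\mathcal Y$ and $\Pr(y_t\mid x^t,z^t,y^{t-1})=\Pr(y_t\mid z_t)=P_t(y_t,z_t)$. The receiver has memory $M_t\in\mathcal M$, with $M_0=1$ and $M_t=l_t(Y_t,M_{t-1})$ for $t=1,\dots,T-1$, and produces the estimate $\widehat X_t=g_t(Y_t,M_{t-1})\in\mathcal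 X$ for $t=1,\dots,T$. Distortion functions $\rho_t:\mathcal X\times\mathcal X\to[0,\infty)$ are given. For a finite set $S$, $\mathcal P^{S}$ is the space of probability mass functions on $S$. The encoding rules considered are $c=(c_1,\dots,c_T)$ with each $c_t\in\mathscr C_S$, the family of functions from $\mathcal X\times\mathcal P^{\mathcal M}$ to $\mathcal Z$, used as $Z_t=c_t(X_t,P_{M_{t-1}})$. The memory update rules are $l=(l_1,\dots,l_{T-1})$ with each $l_t\in\mathscr L$, the family of functions from $\mathcal Y\times\mathcal M$ to $\mathcal M$. Beliefs. $P_{M_t}(m)=\Pr(M_t=m\mid X^t,Z^t,c^t,l^t)$ is the encoder's belief about the receiver's memory contents, and $P_{Y_t,M_{t-1}}(y,m)=\Pr(Y_t=y,M_{t-1}=m\mid X^t,Z^t,c^t,l^{t-1})$ is the encoder's belief about the channel output and the memory contents. For arbitrary but fixed rules $c,l$ these are random vectors in $\mathcal P^{\mathcal M}$ and $\mathcal P^{\mathcal Y\times\mathcal M}$. Since $M_0=1$, $P_{M_0}$ is the point mass at $1$. Information states. $\Pi$ (resp. $\Phi$) is the space of probability measures on $\mathcal X\times\mathcal P^{\mathcal M}$ (resp. $\mathcal X\times\mathcal P^{\mathcal Y\times\mathcal M}$). $\pi_t=\Pr(X_t,P_{M_{t-1}})\in\Pi$ is the joint law of $(X_t,P_{M_{t-1}})$, and $\varphi_t=\Pr(X_t,P_{Y_t,M_{t-1}})\in\Phi$ is the joint law of $(X_t,P_{Y_t,M_{t-1}})$. Optimal decoder. For fixed $c^t,l^{t-1}$,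 an optimal decoding rule at stage $t$ is $g_t^*(y,m)=\arg\min_{\hat x}\sum_{x\in\mathcal X}\rho_t(x,\hat x)\,\xi_t(y,m)(x)$ with $\xi_t(y,m)(x)=\Pr(X_t=x\mid Y_t=y,M_{t-1}=m)$. It depends on the design only through $c^t$ and $l^{t-1}$ and is written $g_t^*(c^t,l^{t-1})$. *)

theory Defs
  imports "HOL-Probability.Probability"
begin

text \<open>
  The finite alphabets are types of class \<^class>\<open>finite\<close>: \<open>'x\<close> for the source, \<open>'z\<close> for the
  channel inputs, \<open>'y\<close> for the channel outputs, \<open>'m\<close> for the receiver's memory.
  \<open>trans S t x\<close> is the law of $X_{t+1}$ given $X_t = x$, and \<open>chan S t z\<close> is the law
  $P_t(\cdot, z)$ of $Y_t$ given $Z_t = z$; \<open>init_mem S\<close> is the fixed initial memory contents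
  $M_0$ (the element called 1 when the memory set is enumerated).
\<close>

record ('x, 'z, 'y, 'm) comm_system =
  init :: "'x pmf"
  trans :: "nat \<Rightarrow> 'x \<Rightarrow> 'x pmf"
  chan :: "nat \<Rightarrow> 'z \<Rightarrow> 'y pmf"
  init_mem :: 'm

text \<open>The simplex of mass functions on a finite set is \<^typ>\<open>'a pmf\<close>.\<close>

type_synonym ('x, 'z, 'm) encoder = "'x \<times> 'm pmf \<Rightarrow> 'z"
type_synonym ('y, 'm) mem_update = "'y \<times> 'm \<Rightarrow> 'm"

text \<open>
  A sample point is the list of the triples $(X_s, Z_s, Y_s)$ for $s = 1, 2, \dots$; stage \<open>s\<close>
  sits at list position \<open>s - 1\<close>.  The memory $M_t$ is a function of $Y^t$ through the update rules.
\<close>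

type_synonym ('x, 'z, 'y) traj = "('x \<times> 'z \<times> 'y) list"

definition X_at :: "nat \<Rightarrow> ('x, 'z, 'y) traj \<Rightarrow> 'x" where
  "X_at t \<omega> = fst (\<omega> ! (t - 1))"

definition Z_at :: "nat \<Rightarrow> ('x, 'z, 'y) traj \<Rightarrow> 'z" where
  "Z_at t \<omega> = fst (snd (\<omega> ! (t - 1)))"

definition Y_at :: "nat \<Rightarrow> ('x, 'z, 'y) traj \<Rightarrow> 'y" where
  "Y_at t \<omega> = snd (snd (\<omega> ! (t - 1)))"

primrec mem :: "('x, 'z, 'y, 'm) comm_system \<Rightarrow> (nat \<Rightarrow> ('y, 'm) mem_update) \<Rightarrow>
    nat \<Rightarrow> ('x, 'z, 'y) traj \<Rightarrow> 'm" where
  "mem S l 0 \<omega> = init_mem S"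
| "mem S l (Suc t) \<omega> = l (Suc t) (Y_at (Suc t) \<omega>, mem S l t \<omega>)"

definition same_XZ :: "nat \<Rightarrow> ('x, 'z, 'y) traj \<Rightarrow> ('x, 'z, 'y) traj set" where
  "same_XZ t \<omega> = {\<omega>'. \<forall>s\<in>{1..t}. X_at s \<omega>' = X_at s \<omega> \<and> Z_at s \<omega>' = Z_at s \<omega>}"

text \<open>
  The beliefs are conditional laws given $(X^t, Z^t)$, under a law \<open>J\<close> of the stages up to \<open>t\<close>.
  They are meaningful for \<open>\<omega>\<close> whose conditioning event has positive probability, hence almost
  surely.
\<close>

definition mem_belief :: "('x, 'z, 'y, 'm) comm_system \<Rightarrow> (nat \<Rightarrow> ('y, 'm) mem_update) \<Rightarrow>
    ('x, 'z, 'y) traj pmf \<Rightarrow> nat \<Rightarrow> ('x, 'z, 'y) traj \<Rightarrow> 'm pmf" where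
  "mem_belief S l J t \<omega> = map_pmf (mem S l t) (cond_pmf J (same_XZ t \<omega>))"

definition out_mem_belief :: "('x, 'z, 'y, 'm) comm_system \<Rightarrow> (nat \<Rightarrow> ('y, 'm) mem_update) \<Rightarrow>
    ('x, 'z, 'y) traj pmf \<Rightarrow> nat \<Rightarrow> ('x, 'z, 'y) traj \<Rightarrow> ('y \<times> 'm) pmf" where
  "out_mem_belief S l J t \<omega> =
     map_pmf (\<lambda>\<omega>'. (Y_at t \<omega>', mem S l (t - 1) \<omega>')) (cond_pmf J (same_XZ t \<omega>))"

text \<open>
  The joint law of the stages $1, \dots, t$ under the design \<open>(c, l)\<close>.  The source evolves on its
  own, the encoder uses $Z_t = c_t(X_t, P_{M_{t-1}})$, and the channel output depends on the past
  only through $Z_t$.  The law of the first \<open>t\<close> stages involves only $c^t$ and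
  $l^{t-1}$, and these laws are consistent in \<open>t\<close>, so that events of the stages up to \<open>t\<close> can be
  evaluated under the law of the first \<open>t\<close> stages.
\<close>

primrec traj_law :: "('x, 'z, 'y, 'm) comm_system \<Rightarrow> (nat \<Rightarrow> ('x, 'z, 'm) encoder) \<Rightarrow>
    (nat \<Rightarrow> ('y, 'm) mem_update) \<Rightarrow> nat \<Rightarrow> ('x, 'z, 'y) traj pmf" where
  "traj_law S c l 0 = return_pmf []"
| "traj_law S c l (Suc t) =
     do {
       \<omega> \<leftarrow> traj_law S c l t;
       x \<leftarrow> (if t = 0 then init S else trans S t (X_at t \<omega>));
       let z = c (Suc t) (x, mem_belief S l (traj_law S c l t) t \<omega>);
       y \<leftarrow> chan S (Suc t) z;
       return_pmf (\<omega> @ [(x, z, y)])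
     }"

lemma length_traj_law: "\<omega> \<in> set_pmf (traj_law S c l n) \<Longrightarrow> length \<omega> = n"
  by (induction n arbitrary: \<omega>) (auto simp: Let_def split: if_splits)

lemma map_take_traj_law: "t \<le> n \<Longrightarrow> map_pmf (take t) (traj_law S c l n) = traj_law S c l t"
proof (induction n)
  case 0 then show ?case by simp
next
  case (Suc n)
  show ?case
  proof (cases "t = Suc n")
    case True
    then have "map_pmf (take t) (traj_law S c l (Suc n)) = map_pmf (\<lambda>w. w) (traj_law S c l (Suc n))"
      using length_traj_law[of _ S c l "Suc n"] by (intro map_pmf_cong refl) auto
    then show ?thesis using True by simp
  next
    case False
    then have "t \<le> n" using Suc.prems by simp
    have "map_pmf (take t) (traj_law S c l (Suc n)) =
        bind_pmf (traj_law S c l n) (\<lambda>w. return_pmf (take t w))"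
      unfolding traj_law.simps Let_def map_bind_pmf map_return_pmf
      using length_traj_law[of _ S c l n] \<open>t \<le> n\<close>
      by (intro bind_pmf_cong refl) simp
    also have "\<dots> = traj_law S c l t"
      using Suc.IH[OF \<open>t \<le> n\<close>] by (simp add: map_pmf_def)
    finally show ?thesis .
  qed
qed

text \<open>
  The simplex carries its Borel sets, as a subset of Euclidean space; the spaces of information
  states are the probability measures on \<open>info_space\<close>, that is
  \<open>space (prob_algebra info_space)\<close>, at \<open>'a = 'm\<close> and \<open>'a = 'y \<times> 'm\<close>.
\<close>

definition simplex_borel :: "'a::finite pmf measure" where
  "simplex_borel = vimage_algebra UNIV (\<lambda>p. (\<chi> i. pmf p i) :: real ^ 'a) borel"

definition info_space :: "('x \<times> 'a::finite pmf) measure" where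
  "info_space = count_space UNIV \<Otimes>\<^sub>M simplex_borel"

text \<open>$P_{M_{t-1}}$ is computed under the law of the first \<open>t - 1\<close> stages.\<close>

definition enc_info :: "('x, 'z, 'y, 'm::finite) comm_system \<Rightarrow> (nat \<Rightarrow> ('x, 'z, 'm) encoder) \<Rightarrow>
    (nat \<Rightarrow> ('y, 'm) mem_update) \<Rightarrow> nat \<Rightarrow> ('x \<times> 'm pmf) measure" where
  "enc_info S c l t = distr (measure_pmf (traj_law S c l t)) info_space
     (\<lambda>\<omega>. (X_at t \<omega>, mem_belief S l (traj_law S c l (t - 1)) (t - 1) \<omega>))"

definition mem_info :: "('x, 'z, 'y::finite, 'm::finite) comm_system \<Rightarrow>
    (nat \<Rightarrow> ('x, 'z, 'm) encoder) \<Rightarrow> (nat \<Rightarrow> ('y, 'm) mem_update) \<Rightarrow> nat \<Rightarrow>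
    ('x \<times> ('y \<times> 'm) pmf) measure" where
  "mem_info S c l t = distr (measure_pmf (traj_law S c l t)) info_space
     (\<lambda>\<omega>. (X_at t \<omega>, out_mem_belief S l (traj_law S c l t) t \<omega>))"

text \<open>
  Finite signed measures on \<open>N\<close> as set functions, extended by 0 to the non-measurable sets (the
  convention of \<^const>\<open>measure\<close>), so that they form a real vector space under pointwise
  operations.
\<close>

definition signed_measures :: "'a measure \<Rightarrow> ('a set \<Rightarrow> real) set" where
  "signed_measures N = {\<nu>. \<nu> {} = 0 \<and>
     (\<forall>A. range A \<subseteq> sets N \<longrightarrow> disjoint_family A \<longrightarrow> (\<lambda>n::nat. \<nu> (A n)) sums \<nu> (\<Union>n. A n)) \<and>
     (\<forall>B. B \<notin> sets N \<longrightarrow> \<nu> B = 0)}"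

definition linear_signed :: "'a measure \<Rightarrow> 'b measure \<Rightarrow>
    (('a set \<Rightarrow> real) \<Rightarrow> ('b set \<Rightarrow> real)) \<Rightarrow> bool" where
  "linear_signed N N' L \<longleftrightarrow>
     L ` signed_measures N \<subseteq> signed_measures N' \<and>
     (\<forall>\<nu>\<in>signed_measures N. \<forall>\<nu>'\<in>signed_measures N. L (\<lambda>B. \<nu> B + \<nu>' B) = (\<lambda>B. L \<nu> B + L \<nu>' B)) \<and>
     (\<forall>\<nu>\<in>signed_measures N. \<forall>a. L (\<lambda>B. a * \<nu> B) = (\<lambda>B. a * L \<nu> B))"

text \<open>
  A linear transformation from the probability measures on \<open>N\<close> to those on \<open>N'\<close>: a map which is
  the restriction of a linear map between the spaces of finite signed measures.
\<close>

definition linear_transformation :: "'a measure \<Rightarrow> 'b measure \<Rightarrow>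
    ('a measure \<Rightarrow> 'b measure) \<Rightarrow> bool" where
  "linear_transformation N N' Q \<longleftrightarrow>
     Q ` space (prob_algebra N) \<subseteq> space (prob_algebra N') \<and>
     (\<exists>L. linear_signed N N' L \<and> (\<forall>\<mu>\<in>space (prob_algebra N). measure (Q \<mu>) = L (measure \<mu>)))"

text \<open>
  \<open>posterior S c l t (y, m) x\<close> is $\xi_t(y,m)(x)$.  By the convention \<open>0 / 0 = 0\<close> of
  \<^const>\<open>cond_prob\<close>, every value of a decoder at a pair \<open>(y, m)\<close> of probability 0 is optimal.
\<close>

definition posterior :: "('x, 'z, 'y, 'm) comm_system \<Rightarrow> (nat \<Rightarrow> ('x, 'z, 'm) encoder) \<Rightarrow>
    (nat \<Rightarrow> ('y, 'm) mem_update) \<Rightarrow> nat \<Rightarrow> 'y \<times> 'm \<Rightarrow> 'x \<Rightarrow> real" where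
  "posterior S c l t ym x =
     \<P>(\<omega> in measure_pmf (traj_law S c l t). X_at t \<omega> = x \<bar> (Y_at t \<omega>, mem S l (t - 1) \<omega>) = ym)"

definition optimal_decoder :: "('x::finite, 'z, 'y, 'm) comm_system \<Rightarrow>
    (nat \<Rightarrow> 'x \<Rightarrow> 'x \<Rightarrow> real) \<Rightarrow> (nat \<Rightarrow> ('x, 'z, 'm) encoder) \<Rightarrow> (nat \<Rightarrow> ('y, 'm) mem_update) \<Rightarrow>
    nat \<Rightarrow> ('y \<times> 'm \<Rightarrow> 'x) \<Rightarrow> bool" where
  "optimal_decoder S \<rho> c l t g \<longleftrightarrow>
     (\<forall>ym. is_arg_min (\<lambda>xh. \<Sum>x\<in>UNIV. \<rho> t x xh * posterior S c l t ym x) (\<lambda>_. True) (g ym))"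

definition expected_cost :: "('x, 'z, 'y, 'm) comm_system \<Rightarrow>
    (nat \<Rightarrow> 'x \<Rightarrow> 'x \<Rightarrow> real) \<Rightarrow> (nat \<Rightarrow> ('x, 'z, 'm) encoder) \<Rightarrow> (nat \<Rightarrow> ('y, 'm) mem_update) \<Rightarrow>
    nat \<Rightarrow> ('y \<times> 'm \<Rightarrow> 'x) \<Rightarrow> real" where
  "expected_cost S \<rho> c l t g =
     measure_pmf.expectation (traj_law S c l t)
       (\<lambda>\<omega>. \<rho> t (X_at t \<omega>) (g (Y_at t \<omega>, mem S l (t - 1) \<omega>)))"

end

theory Submission
  imports Defs
begin

text \<open>
  Given $(X^t, Z^t)$, the output $Y_t$ is independent of $M_{t-1}$, and $(X_t, Z_t)$ carries no
  information on $M_{t-1}$ beyond that of $(X^{t-1}, Z^{t-1})$.  Hence $P_{Y_t,M_{t-1}}$ is the product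
  of the law $P_t(\cdot, c_t(X_t, P_{M_{t-1}}))$ and $P_{M_{t-1}}$, while $P_{M_t}$ is the image of
  $P_{Y_t,M_{t-1}}$ under $l_t$: both information states evolve by Markov kernels depending only on
  $c_t$ or $l_t$.  By the tower property $\varphi_t$ determines the joint law of
  $(X_t, Y_t, M_{t-1})$, hence the minimal expected distortion.

  An encoder need not be measurable, so its kernel cannot be integrated against an arbitrary
  measure.  The states reached by the system are purely atomic, and the linear map acts through the
  kernel on the atoms of a signed measure and moves the remaining diffuse mass to a fixed point.
\<close>

subsection \<open>Linear maps of signed measures\<close>

text \<open>Countable additivity on the union of the points \<open>s n\<close> with
  \<open>P n\<close> makes each such subseries converge, the omitted indices contributing the empty
  set. Splitting by sign into two subseries then gives absolute convergence.\<close>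

lemma summable_atoms:
  assumes \<nu>: "\<nu> \<in> signed_measures N" and N: "\<And>a. {a} \<in> sets N" and s: "inj (s :: nat \<Rightarrow> 'a)"
  shows "summable (\<lambda>n. \<bar>\<nu> {s n}\<bar>)"
proof -
  have part: "summable (\<lambda>n. if P n then \<nu> {s n} else 0)" for P
  proof -
    define A where "A n = (if P n then {s n} else {})" for n
    have "range A \<subseteq> sets N" "disjoint_family A"
      using N s by (auto simp: A_def disjoint_family_on_def dest: injD)
    then have "summable (\<lambda>n. \<nu> (A n))"
      using \<nu> unfolding signed_measures_def by (auto intro: sums_summable)
    moreover have "\<nu> (A n) = (if P n then \<nu> {s n} else 0)" for n
      using \<nu> by (simp add: A_def signed_measures_def)
    ultimately show ?thesis by simp
  qed
  have "summable (\<lambda>n. (if 0 < \<nu> {s n} then \<nu> {s n} else 0) - (if \<not> 0 < \<nu> {s n} then \<nu> {s n} else 0))"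
    by (intro summable_diff part)
  then show ?thesis
    by (rule summable_cong[THEN iffD1, rotated]) (auto intro!: always_eventually)
qed

text \<open>Infinitely many atoms of size above \<open>e\<close> would give an injective sequence
  whose masses do not tend to 0, against \<open>summable_atoms\<close>. So only countably many
  points carry mass, and enumerating them reduces integrability to absolute summability.\<close>

lemma integrable_atoms:
  assumes \<nu>: "\<nu> \<in> signed_measures N" and N: "\<And>a. {a} \<in> sets N"
  shows "integrable (count_space UNIV) (\<lambda>a. \<nu> {a})"
proof -
  define C where "C = {a. \<nu> {a} \<noteq> 0}"
  have fin: "finite {a. \<bar>\<nu> {a}\<bar> > e}" if "e > 0" for e
  proof (rule ccontr)
    assume "infinite {a. \<bar>\<nu> {a}\<bar> > e}"
    then obtain s :: "nat \<Rightarrow> 'a" where s: "inj s" "range s \<subseteq> {a. \<bar>\<nu> {a}\<bar> > e}"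
      using infinite_countable_subset by blast
    have "(\<lambda>n. \<bar>\<nu> {s n}\<bar>) \<longlonglongrightarrow> 0"
      using summable_atoms[OF \<nu> N s(1)] by (rule summable_LIMSEQ_zero)
    then have "e \<le> 0"
      by (rule LIMSEQ_le_const) (use s(2) in \<open>auto intro!: exI[of _ 0] less_imp_le\<close>)
    with that show False by simp
  qed
  have "C \<subseteq> (\<Union>n. {a. \<bar>\<nu> {a}\<bar> > 1 / real (Suc n)})"
  proof
    fix a assume "a \<in> C"
    then obtain n where "1 / real (Suc n) < \<bar>\<nu> {a}\<bar>"
      using nat_approx_posE[of "\<bar>\<nu> {a}\<bar>"] unfolding C_def by auto
    then show "a \<in> (\<Union>n. {a. \<bar>\<nu> {a}\<bar> > 1 / real (Suc n)})" by blast
  qed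
  moreover have "countable (\<Union>n. {a. \<bar>\<nu> {a}\<bar> > 1 / real (Suc n)})"
    using fin by (intro countable_UN) (simp_all add: countable_finite)
  ultimately have "countable C"
    by (rule countable_subset)
  have "Infinite_Set_Sum.abs_summable_on (\<lambda>a. \<nu> {a}) C"
  proof (cases "finite C")
    case False
    then have bij: "bij_betw (from_nat_into C) UNIV C"
      using \<open>countable C\<close> by (simp add: bij_betw_from_nat_into)
    then have "summable (\<lambda>n. \<bar>\<nu> {from_nat_into C n}\<bar>)"
      by (intro summable_atoms[OF \<nu> N]) (auto simp: bij_betw_def)
    then show ?thesis
      by (subst abs_summable_on_reindex_bij_betw[OF bij, symmetric])
         (simp add: abs_summable_on_nat_iff')
  qed auto
  then have "Infinite_Set_Sum.abs_summable_on (\<lambda>a. \<nu> {a}) UNIV"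
    by (subst abs_summable_on_cong_neutral[of UNIV C _ "\<lambda>a. \<nu> {a}"]) (auto simp: C_def)
  then show ?thesis by (simp add: abs_summable_on_def)
qed

lemma integrable_atoms_kernel:
  assumes \<nu>: "\<nu> \<in> signed_measures N" and N: "\<And>a. {a} \<in> sets N"
  shows "integrable (count_space UNIV) (\<lambda>a. \<nu> {a} * measure (measure_pmf (K a)) B)"
  by (rule Bochner_Integration.integrable_bound[OF integrable_atoms[OF assms]])
     (auto simp: abs_mult intro!: mult_left_le)

lemma measure_in_signed_measures:
  assumes "finite_measure \<mu>" "sets \<mu> = sets N"
  shows "measure \<mu> \<in> signed_measures N"
  using finite_measure.finite_measure_UNION[OF assms(1)] assms(2)
  by (auto simp: signed_measures_def measure_notin_sets)

text \<open>The points of positive mass form a countable set, whose measure is the sum of its point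
  masses. This makes the diffuse remainder in \<open>atom_push\<close> nonnegative for probability
  measures.\<close>

lemma (in finite_measure) integral_measure_singleton_le:
  assumes "\<And>a. {a} \<in> sets M"
  shows "(\<integral>a. measure M {a} \<partial>count_space UNIV) \<le> measure M (space M)"
proof -
  define C where "C = {a. measure M {a} \<noteq> 0}"
  have "countable C"
    unfolding C_def by (rule countable_support)
  have "(\<integral>\<^sup>+a. ennreal (measure M {a}) \<partial>count_space UNIV) = (\<integral>\<^sup>+a. emeasure M {a} \<partial>count_space C)"
    unfolding emeasure_eq_measure by (rule nn_integral_count_space_eq) (auto simp: C_def)
  also have "\<dots> = emeasure M C"
    by (intro emeasure_countable_singleton[symmetric] assms \<open>countable C\<close>)
  also have "\<dots> \<le> ennreal (measure M (space M))"
    unfolding emeasure_eq_measure by (rule ennreal_leI[OF bounded_measure])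
  finally have *: "(\<integral>\<^sup>+a. ennreal (measure M {a}) \<partial>count_space UNIV) \<le> ennreal (measure M (space M))" .
  have "integrable (count_space UNIV) (\<lambda>a. measure M {a})"
    by (rule integrable_atoms[OF measure_in_signed_measures[OF finite_measure_axioms refl] assms])
  then have "(\<integral>\<^sup>+a. ennreal (measure M {a}) \<partial>count_space UNIV) =
      ennreal (\<integral>a. measure M {a} \<partial>count_space UNIV)"
    by (intro nn_integral_eq_integral) auto
  with * show ?thesis by (simp add: ennreal_le_iff)
qed

text \<open>Passes from set functions back to measures: countable additivity comes from
  \<open>L\<close> mapping into \<open>signed_measures N'\<close>, and only sign and total mass
  remain to be supplied. Outside \<open>sets N'\<close> both \<open>measure\<close> and the signed
  measures are 0, so the required equality of set functions holds everywhere.\<close>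

lemma linear_transformation_measure_of:
  assumes lin: "linear_signed N N' L"
    and nonneg: "\<And>\<mu> B. \<mu> \<in> space (prob_algebra N) \<Longrightarrow> B \<in> sets N' \<Longrightarrow> 0 \<le> L (measure \<mu>) B"
    and mass: "\<And>\<mu>. \<mu> \<in> space (prob_algebra N) \<Longrightarrow> L (measure \<mu>) (space N') = 1"
  shows "linear_transformation N N' (\<lambda>\<mu>. measure_of (space N') (sets N') (\<lambda>B. ennreal (L (measure \<mu>) B)))"
    (is "linear_transformation N N' ?Q")
proof -
  have Q: "?Q \<mu> \<in> space (prob_algebra N') \<and> measure (?Q \<mu>) = L (measure \<mu>)"
    if \<mu>: "\<mu> \<in> space (prob_algebra N)" for \<mu>
  proof -
    have "measure \<mu> \<in> signed_measures N"
      using \<mu> by (auto simp: space_prob_algebra prob_space_def intro!: measure_in_signed_measures)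
    then have L: "L (measure \<mu>) \<in> signed_measures N'"
      using lin by (auto simp: linear_signed_def)
    have "countably_additive (sets N') (\<lambda>B. ennreal (L (measure \<mu>) B))"
    proof (rule countably_additiveI)
      fix A :: "nat \<Rightarrow> _" assume A: "range A \<subseteq> sets N'" "disjoint_family A"
      then have "(\<lambda>n. L (measure \<mu>) (A n)) sums L (measure \<mu>) (\<Union>n. A n)"
        using L by (simp add: signed_measures_def)
      then show "(\<Sum>n. ennreal (L (measure \<mu>) (A n))) = ennreal (L (measure \<mu>) (\<Union>n. A n))"
        using A nonneg[OF \<mu>] by (subst suminf_ennreal_eq) auto
    qed
    moreover have "positive (sets N') (\<lambda>B. ennreal (L (measure \<mu>) B))"
      using L by (simp add: positive_def signed_measures_def)
    ultimately have em: "emeasure (?Q \<mu>) B = ennreal (L (measure \<mu>) B)" if "B \<in> sets N'" for B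
      using that by (intro emeasure_measure_of_sigma sets.sigma_algebra_axioms)
    have sets: "sets (?Q \<mu>) = sets N'" "space (?Q \<mu>) = space N'" by simp_all
    have "prob_space (?Q \<mu>)"
      by (rule prob_spaceI) (use em mass[OF \<mu>] in \<open>simp add: sets\<close>)
    moreover have "measure (?Q \<mu>) B = L (measure \<mu>) B" for B
    proof (cases "B \<in> sets N'")
      case True
      then show ?thesis
        using em[OF True] nonneg[OF \<mu> True] unfolding measure_def by simp
    next
      case False
      then show ?thesis
        using L by (simp add: measure_notin_sets signed_measures_def)
    qed
    ultimately show ?thesis
      using sets by (auto simp: space_prob_algebra)
  qed
  show ?thesis
    unfolding linear_transformation_def
    using Q lin by blast
qed

text \<open>The term in \<^const>\<open>undefined\<close> (an arbitrary point) places the diffuse mass, so that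
  total mass is preserved.\<close>

definition atom_push :: "'b measure \<Rightarrow> ('a \<Rightarrow> 'b pmf) \<Rightarrow> ('a set \<Rightarrow> real) \<Rightarrow> 'b set \<Rightarrow> real" where
  "atom_push N' K \<nu> B =
     (if B \<in> sets N' then (\<integral>a. \<nu> {a} * measure (measure_pmf (K a)) B \<partial>count_space UNIV)
        + (\<nu> UNIV - (\<integral>a. \<nu> {a} \<partial>count_space UNIV)) * indicator B undefined
      else 0)"

definition atom_kernel :: "'b measure \<Rightarrow> ('a \<Rightarrow> 'b pmf) \<Rightarrow> 'a measure \<Rightarrow> 'b measure" where
  "atom_kernel N' K \<mu> = measure_of (space N') (sets N') (\<lambda>B. ennreal (atom_push N' K (measure \<mu>) B))"

text \<open>Dominated convergence exchanges the series over \<open>A\<close> with the integral over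
  the atoms: for disjoint sets the partial sums at \<open>a\<close> are at most
  \<open>\<bar>\<nu> {a}\<bar>\<close>.\<close>

lemma atom_push_signed:
  assumes \<nu>: "\<nu> \<in> signed_measures N" and N: "\<And>a. {a} \<in> sets N"
  shows "atom_push N' K \<nu> \<in> signed_measures N'"
  unfolding signed_measures_def
proof (intro CollectI conjI allI impI)
  fix A :: "nat \<Rightarrow> _" assume A: "range A \<subseteq> sets N'" "disjoint_family A"
  have *: "(\<lambda>n. measure M (A n)) sums measure M (\<Union>n. A n)"
    if "prob_space M" "sets M = UNIV" for M
    using that A by (intro finite_measure.finite_measure_UNION) (auto simp: prob_space_def)
  have "(\<lambda>n. \<integral>a. (\<Sum>k<n. \<nu> {a} * measure (measure_pmf (K a)) (A k)) \<partial>count_space UNIV)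
      \<longlonglongrightarrow> (\<integral>a. \<nu> {a} * measure (measure_pmf (K a)) (\<Union>n. A n) \<partial>count_space UNIV)"
  proof (rule integral_dominated_convergence[where w = "\<lambda>a. \<bar>\<nu> {a}\<bar>"])
    show "integrable (count_space UNIV) (\<lambda>a. \<bar>\<nu> {a}\<bar>)"
      using integrable_atoms[OF \<nu> N] by simp
    show "AE a in count_space UNIV. (\<lambda>n. \<Sum>k<n. \<nu> {a} * measure (measure_pmf (K a)) (A k))
        \<longlonglongrightarrow> \<nu> {a} * measure (measure_pmf (K a)) (\<Union>n. A n)"
      using *[OF measure_pmf.prob_space_axioms]
      by (intro AE_I2) (auto simp: sums_def[symmetric] intro!: sums_mult)
    show "AE a in count_space UNIV. norm (\<Sum>k<n. \<nu> {a} * measure (measure_pmf (K a)) (A k)) \<le> \<bar>\<nu> {a}\<bar>" for n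
    proof (rule AE_I2)
      fix a
      have "(\<Sum>k<n. measure (measure_pmf (K a)) (A k)) = measure (measure_pmf (K a)) (\<Union>k<n. A k)"
        using A(2) by (intro measure_pmf.finite_measure_finite_Union[symmetric])
           (auto simp: disjoint_family_on_def)
      then show "norm (\<Sum>k<n. \<nu> {a} * measure (measure_pmf (K a)) (A k)) \<le> \<bar>\<nu> {a}\<bar>"
        by (simp add: sum_distrib_left[symmetric] abs_mult mult_left_le)
    qed
  qed auto
  then have "(\<lambda>n. \<integral>a. \<nu> {a} * measure (measure_pmf (K a)) (A n) \<partial>count_space UNIV)
      sums (\<integral>a. \<nu> {a} * measure (measure_pmf (K a)) (\<Union>n. A n) \<partial>count_space UNIV)"
    unfolding sums_def
    by (subst (asm) Bochner_Integration.integral_sum) (auto intro: integrable_atoms_kernel[OF \<nu> N])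
  \<comment> \<open>The indicator is the point mass at \<open>undefined\<close>, so its additivity
    is that of \<open>return_pmf undefined\<close>.\<close>
  moreover have "(\<lambda>n. indicator (A n) undefined :: real) sums indicator (\<Union>n. A n) undefined"
    using *[OF measure_pmf.prob_space_axioms, of "return_pmf undefined"] by simp
  ultimately show "(\<lambda>n. atom_push N' K \<nu> (A n)) sums atom_push N' K \<nu> (\<Union>n. A n)"
    using A(1) by (auto simp: atom_push_def intro!: sums_add sums_mult)
qed (auto simp: atom_push_def)

text \<open>Additivity rests on integrability over the atoms, since the Bochner integral of a
  non-integrable function is 0 by default and would not split.\<close>

lemma linear_signed_atom_push:
  assumes N: "\<And>a. {a} \<in> sets N"
  shows "linear_signed N N' (atom_push N' K)"
  unfolding linear_signed_def
proof (intro conjI ballI allI)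
  fix \<nu> \<nu>' assume "\<nu> \<in> signed_measures N" "\<nu>' \<in> signed_measures N"
  note int = this[THEN integrable_atoms[OF _ N]] this[THEN integrable_atoms_kernel[OF _ N]]
  have "(\<integral>a. (\<nu> {a} + \<nu>' {a}) * measure (measure_pmf (K a)) B \<partial>count_space UNIV) =
      (\<integral>a. \<nu> {a} * measure (measure_pmf (K a)) B \<partial>count_space UNIV) +
      (\<integral>a. \<nu>' {a} * measure (measure_pmf (K a)) B \<partial>count_space UNIV)" for B
    unfolding distrib_right by (intro Bochner_Integration.integral_add int)
  then show "atom_push N' K (\<lambda>B. \<nu> B + \<nu>' B) = (\<lambda>B. atom_push N' K \<nu> B + atom_push N' K \<nu>' B)"
    using int(1,2) by (simp add: fun_eq_iff atom_push_def) (simp add: algebra_simps)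
next
  fix \<nu> r assume "\<nu> \<in> signed_measures N"
  show "atom_push N' K (\<lambda>B. r * \<nu> B) = (\<lambda>B. r * atom_push N' K \<nu> B)"
    by (auto simp: fun_eq_iff atom_push_def algebra_simps)
qed (auto intro: atom_push_signed[OF _ N])

text \<open>On the whole space the first term of \<open>atom_push\<close> is the mass of the atoms
  and the second is the rest, so they add up to 1. The kernel \<open>K\<close> is arbitrary because
  every function is measurable on \<open>count_space UNIV\<close>.\<close>

lemma linear_transformation_atom_kernel:
  assumes N: "\<And>a. {a} \<in> sets N" and N': "space N' = UNIV"
  shows "linear_transformation N N' (atom_kernel N' K)"
  unfolding atom_kernel_def
proof (rule linear_transformation_measure_of[OF linear_signed_atom_push[OF N]])
  fix \<mu> assume "\<mu> \<in> space (prob_algebra N)"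
  then have sets: "sets \<mu> = sets N" and "prob_space \<mu>"
    by (auto simp: space_prob_algebra)
  interpret prob_space \<mu> by fact
  have space: "space \<mu> = UNIV"
    using N sets sets.sets_into_space[of "{_}" \<mu>] by auto
  show "atom_push N' K (measure \<mu>) (space N') = 1"
    using prob_space space by (simp add: atom_push_def N'[symmetric]) (simp add: N')
  show "0 \<le> atom_push N' K (measure \<mu>) B" for B
    using integral_measure_singleton_le N sets space
    by (auto simp: atom_push_def intro!: add_nonneg_nonneg mult_nonneg_nonneg integral_nonneg)
qed

section \<open>Action of the linear map on discrete laws\<close>

lemma measure_bind_pmf:
  "measure (measure_pmf (bind_pmf P K)) B = (\<integral>a. measure (measure_pmf (K a)) B \<partial>measure_pmf P)"
proof -
  have "ennreal (measure (measure_pmf (bind_pmf P K)) B) =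
      (\<integral>\<^sup>+a. ennreal (measure (measure_pmf (K a)) B) \<partial>measure_pmf P)"
    by (simp flip: measure_pmf.emeasure_eq_measure)
  also have "\<dots> = ennreal (\<integral>a. measure (measure_pmf (K a)) B \<partial>measure_pmf P)"
    by (intro nn_integral_eq_integral measure_pmf.integrable_const_bound[of _ 1]) auto
  finally show ?thesis
    by (subst (asm) ennreal_inj) auto
qed

text \<open>Links the linear map to the actual dynamics. \<open>distr\<close> along the identity
  equips a discrete law with the sigma-algebra of \<open>N\<close> or \<open>N'\<close>.\<close>

lemma atom_kernel_pmf:
  fixes P :: "'a pmf"
  assumes N: "\<And>a. {a} \<in> sets N" and N': "space N' = UNIV"
  shows "atom_kernel N' K (distr (measure_pmf P) N (\<lambda>a. a)) =
    distr (measure_pmf (bind_pmf P K)) N' (\<lambda>b. b)"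
proof -
  have space: "space N = UNIV"
    using N sets.sets_into_space[of "{_}" N] by auto
  then have P: "measure (distr (measure_pmf P) N (\<lambda>a. a)) {a} = pmf P a" for a
    by (simp add: measure_distr N pmf.rep_eq)
  have UN: "measure (distr (measure_pmf P) N (\<lambda>a. a)) UNIV = 1"
    using sets.top[of N] by (simp add: measure_distr space)
  \<comment> \<open>The atoms of a discrete law have total mass 1, which removes the diffuse term;
    the remaining weighted sum is an integral against \<open>P\<close>, written through its
    density.\<close>
  have push: "atom_push N' K (measure (distr (measure_pmf P) N (\<lambda>a. a))) B =
      measure (measure_pmf (bind_pmf P K)) B" if "B \<in> sets N'" for B
    using that by (simp add: atom_push_def P UN integral_pmf measure_bind_pmf)
      (simp add: measure_pmf_eq_density integral_density)
  show ?thesis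
  proof (rule measure_eqI)
    fix B assume "B \<in> sets (atom_kernel N' K (distr (measure_pmf P) N (\<lambda>a. a)))"
    then have B: "B \<in> sets N'" by (simp add: atom_kernel_def)
    \<comment> \<open>\<open>measure_of\<close> depends only on the values on the generated
      sigma-algebra, so it suffices to compare with the \<open>emeasure\<close> of an existing
      measure.\<close>
    have "measure_of (space N') (sets N') (\<lambda>B. ennreal (atom_push N' K (measure (distr (measure_pmf P) N (\<lambda>a. a))) B)) =
       measure_of (space N') (sets N') (emeasure (distr (measure_pmf (bind_pmf P K)) N' (\<lambda>b. b)))"
    proof (rule measure_of_eq[OF sets.space_closed])
      fix A assume "A \<in> sigma_sets (space N') (sets N')"
      then have "A \<in> sets N'" by (simp add: sets.sigma_sets_eq)
      then show "ennreal (atom_push N' K (measure (distr (measure_pmf P) N (\<lambda>a. a))) A) =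
          emeasure (distr (measure_pmf (bind_pmf P K)) N' (\<lambda>b. b)) A"
        using N' by (simp add: push emeasure_distr measure_pmf.emeasure_eq_measure del: emeasure_bind_pmf)
    qed
    also have "\<dots> = distr (measure_pmf (bind_pmf P K)) N' (\<lambda>b. b)"
      using measure_of_of_measure[of "distr (measure_pmf (bind_pmf P K)) N' (\<lambda>b. b)"] by simp
    finally show "emeasure (atom_kernel N' K (distr (measure_pmf P) N (\<lambda>a. a))) B =
        emeasure (distr (measure_pmf (bind_pmf P K)) N' (\<lambda>b. b)) B"
      by (simp add: atom_kernel_def)
  qed (simp add: atom_kernel_def)
qed

section \<open>Measurability in the space carrying the information states\<close>

lemma space_simplex_borel: "space simplex_borel = UNIV"
  by (simp add: simplex_borel_def)

lemma space_info_space: "space info_space = UNIV"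
  by (simp add: info_space_def space_pair_measure space_simplex_borel)

lemma measurable_pmf_simplex_borel: "(\<lambda>p. pmf p i) \<in> borel_measurable simplex_borel"
proof -
  have "(\<lambda>p. (\<chi> i. pmf p i) :: real ^ 'a) \<in> measurable simplex_borel borel"
    unfolding simplex_borel_def by (rule measurable_vimage_algebra1) simp
  then have "(\<lambda>p. ((\<chi> i. pmf p i) :: real ^ 'a) $ i) \<in> borel_measurable simplex_borel"
    by (rule measurable_compose[OF _ borel_measurable_nth])
  then show ?thesis by simp
qed

text \<open>The coordinate map is injective on mass functions, so a single one is the preimage of a
  closed point. The results on atoms require such measurable singletons.\<close>

lemma singleton_in_info_space: "{a} \<in> sets info_space"
proof -
  obtain x p where a: "a = (x, p)" by force
  have "{p} = (\<lambda>p. (\<chi> i. pmf p i) :: real ^ 'b) -` {\<chi> i. pmf p i} \<inter> UNIV"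
    by (auto simp: vec_eq_iff intro: pmf_eqI)
  also have "\<dots> \<in> sets simplex_borel"
    unfolding simplex_borel_def by (rule in_vimage_algebra) simp
  finally show ?thesis
    using pair_measureI[of "{x}" "count_space UNIV" "{p}" simplex_borel]
    by (simp add: a info_space_def)
qed

subsection \<open>Evolution of the beliefs\<close>

lemma at_append:
  assumes "s \<in> {1..length \<omega>}"
  shows "X_at s (\<omega> @ v) = X_at s \<omega>" "Z_at s (\<omega> @ v) = Z_at s \<omega>" "Y_at s (\<omega> @ v) = Y_at s \<omega>"
  using assms by (auto simp: X_at_def Z_at_def Y_at_def nth_append)

lemma at_snoc:
  "X_at (Suc (length \<omega>)) (\<omega> @ [(x, z, y)]) = x"
  "Z_at (Suc (length \<omega>)) (\<omega> @ [(x, z, y)]) = z"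
  "Y_at (Suc (length \<omega>)) (\<omega> @ [(x, z, y)]) = y"
  by (simp_all add: X_at_def Z_at_def Y_at_def)

lemma mem_append: "n \<le> length \<omega> \<Longrightarrow> mem S l n (\<omega> @ v) = mem S l n \<omega>"
  by (induction n) (auto simp: at_append)

lemma same_XZ_refl [simp]: "\<omega> \<in> same_XZ n \<omega>"
  by (simp add: same_XZ_def)

lemma same_XZ_eq: "\<omega>' \<in> same_XZ n \<omega> \<Longrightarrow> same_XZ n \<omega>' = same_XZ n \<omega>"
  by (auto simp: same_XZ_def)

lemma same_XZ_append: "n \<le> length \<omega> \<Longrightarrow> same_XZ n (\<omega> @ v) = same_XZ n \<omega>"
  by (auto simp: same_XZ_def at_append)

lemma same_XZ_Suc_append_iff:
  assumes "length \<omega> = n" "length \<omega>' = n"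
  shows "\<omega>' @ [(x', z', y')] \<in> same_XZ (Suc n) (\<omega> @ [(x, z, y)]) \<longleftrightarrow>
    \<omega>' \<in> same_XZ n \<omega> \<and> x' = x \<and> z' = z"
  unfolding same_XZ_def
  using assms at_snoc[of \<omega>] at_snoc[of \<omega>']
  by (auto simp: at_append atLeastAtMostSuc_conv)

lemma mem_belief_append:
  "n \<le> length \<omega> \<Longrightarrow> mem_belief S l J n (\<omega> @ v) = mem_belief S l J n \<omega>"
  by (simp add: mem_belief_def same_XZ_append)

definition next_source :: "('x, 'z, 'y, 'm) comm_system \<Rightarrow> nat \<Rightarrow> ('x, 'z, 'y) traj \<Rightarrow> 'x pmf" where
  "next_source S n \<omega> = (if n = 0 then init S else trans S n (X_at n \<omega>))"

definition next_input :: "('x, 'z, 'y, 'm) comm_system \<Rightarrow> (nat \<Rightarrow> ('x, 'z, 'm) encoder) \<Rightarrow>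
    (nat \<Rightarrow> ('y, 'm) mem_update) \<Rightarrow> nat \<Rightarrow> ('x, 'z, 'y) traj \<Rightarrow> 'x \<Rightarrow> 'z" where
  "next_input S c l n \<omega> x = c (Suc n) (x, mem_belief S l (traj_law S c l n) n \<omega>)"

lemma traj_law_Suc:
  "traj_law S c l (Suc n) = bind_pmf (traj_law S c l n) (\<lambda>\<omega>. bind_pmf (next_source S n \<omega>)
     (\<lambda>x. map_pmf (\<lambda>y. \<omega> @ [(x, next_input S c l n \<omega> x, y)]) (chan S (Suc n) (next_input S c l n \<omega> x))))"
  by (simp add: next_source_def next_input_def Let_def map_pmf_def)

lemma next_source_same_XZ: "\<omega>' \<in> same_XZ n \<omega> \<Longrightarrow> next_source S n \<omega>' = next_source S n \<omega>"
  by (auto simp: same_XZ_def next_source_def)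

text \<open>The belief is conditioned on the class \<open>same_XZ n \<omega>\<close>, hence constant
  on it: the encoder reacts in the same way to all trajectories in the class.\<close>

lemma next_input_same_XZ: "\<omega>' \<in> same_XZ n \<omega> \<Longrightarrow> next_input S c l n \<omega>' = next_input S c l n \<omega>"
  by (simp add: fun_eq_iff next_input_def mem_belief_def same_XZ_eq)

text \<open>Within a class of \<open>same_XZ n\<close> the source law and the encoder are constant,
  so once \<open>x\<close> is drawn the input is forced to be \<open>z\<close>, and the channel
  output is drawn independently of the memory. This is the conditional independence behind the
  product form of the belief.\<close>

lemma measure_same_XZ_Suc:
  fixes S :: "('x::finite, 'z, 'y, 'm) comm_system"
  assumes \<omega>: "length \<omega> = n" and z_def: "z = next_input S c l n \<omega> x"
  shows "measure (measure_pmf (traj_law S c l (Suc n)))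
      {\<omega>'. \<omega>' \<in> same_XZ (Suc n) (\<omega> @ [(x, z, y)]) \<and> Y_at (Suc n) \<omega>' \<in> A \<and> mem S l n \<omega>' \<in> B} =
    measure (measure_pmf (traj_law S c l n)) {\<omega>' \<in> same_XZ n \<omega>. mem S l n \<omega>' \<in> B} *
      (pmf (next_source S n \<omega>) x * measure (measure_pmf (chan S (Suc n) z)) A)"
    (is "measure _ ?E = measure _ ?F * ?k")
proof -
  have inner: "measure (measure_pmf (bind_pmf (next_source S n \<omega>')
      (\<lambda>x. map_pmf (\<lambda>y. \<omega>' @ [(x, next_input S c l n \<omega>' x, y)])
        (chan S (Suc n) (next_input S c l n \<omega>' x))))) ?E = indicator ?F \<omega>' * ?k"
    if "\<omega>' \<in> set_pmf (traj_law S c l n)" for \<omega>'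
  proof -
    have len: "length \<omega>' = n" using length_traj_law[OF that] .
    \<comment> \<open>Inside the class the requirement on the new input holds automatically, which
      leaves only the condition on the output.\<close>
    have pre: "(\<lambda>y. \<omega>' @ [(x', next_input S c l n \<omega>' x', y)]) -` ?E =
        (if x' = x \<and> \<omega>' \<in> ?F then A else {})" for x'
      using same_XZ_Suc_append_iff[OF \<omega> len] at_snoc[of \<omega>'] mem_append[of n \<omega>' S l]
        next_input_same_XZ[of \<omega>' n \<omega> S c l]
      by (auto simp: len z_def)
    \<comment> \<open>Source symbols other than \<open>x\<close> have an empty preimage, so the
      integral collapses to one term.\<close>
    have "(\<integral>x'. measure (measure_pmf (chan S (Suc n) (next_input S c l n \<omega>' x')))
        (if x' = x \<and> \<omega>' \<in> ?F then A else {}) \<partial>next_source S n \<omega>') =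
        (\<Sum>x'\<in>{x}. measure (measure_pmf (chan S (Suc n) (next_input S c l n \<omega>' x')))
        (if x' = x \<and> \<omega>' \<in> ?F then A else {}) * pmf (next_source S n \<omega>') x')"
      by (rule integral_measure_pmf_real) (auto split: if_splits)
    also have "\<dots> = indicator ?F \<omega>' * ?k"
      using next_source_same_XZ[of \<omega>' n \<omega> S] next_input_same_XZ[of \<omega>' n \<omega> S c l]
      by (auto simp: z_def)
    finally show ?thesis
      by (simp only: measure_bind_pmf measure_map_pmf pre)
  qed
  have "measure (measure_pmf (traj_law S c l (Suc n))) ?E =
      (\<integral>\<omega>'. indicator ?F \<omega>' * ?k \<partial>traj_law S c l n)"
    unfolding traj_law_Suc measure_bind_pmf[of "traj_law S c l n"]
    using inner by (intro integral_cong_AE) (auto simp: AE_measure_pmf_iff)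
  then show ?thesis by simp
qed

lemma pmf_map_cond_pmf:
  assumes "set_pmf p \<inter> A \<noteq> {}"
  shows "pmf (map_pmf f (cond_pmf p A)) i =
    measure (measure_pmf p) {x \<in> A. f x = i} / measure (measure_pmf p) A"
proof -
  have "pmf (map_pmf f (cond_pmf p A)) i = measure (uniform_measure (measure_pmf p) A) (f -` {i})"
    by (simp add: pmf_map cond_pmf.rep_eq[OF assms])
  also have "\<dots> = measure (measure_pmf p) (A \<inter> f -` {i}) / measure (measure_pmf p) A"
    using measure_measure_pmf_not_zero[OF assms]
    by (intro measure_uniform_measure) (auto simp: measure_pmf.emeasure_eq_measure)
  also have "A \<inter> f -` {i} = {x \<in> A. f x = i}" by auto
  finally show ?thesis .
qed

text \<open>The belief is a ratio of two instances of \<open>measure_same_XZ_Suc\<close>. The source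
  probability of \<open>x\<close> cancels, being positive on the support, and what remains is the
  channel law times the previous belief.\<close>

lemma out_mem_belief_eq:
  fixes S :: "('x::finite, 'z, 'y, 'm) comm_system"
  assumes \<omega>: "\<omega> \<in> set_pmf (traj_law S c l (Suc n))"
  shows "out_mem_belief S l (traj_law S c l (Suc n)) (Suc n) \<omega> =
    (let p = mem_belief S l (traj_law S c l n) n \<omega>
     in pair_pmf (chan S (Suc n) (c (Suc n) (X_at (Suc n) \<omega>, p))) p)"
proof -
  obtain \<omega>0 x y where \<omega>0: "\<omega>0 \<in> set_pmf (traj_law S c l n)"
    and x: "x \<in> set_pmf (next_source S n \<omega>0)"
    and eq: "\<omega> = \<omega>0 @ [(x, next_input S c l n \<omega>0 x, y)]"
    using \<omega> unfolding traj_law_Suc by auto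
  define z where "z = next_input S c l n \<omega>0 x"
  have len: "length \<omega>0 = n" using length_traj_law[OF \<omega>0] .
  note meas = measure_same_XZ_Suc[OF len z_def, of y]
  have bel: "mem_belief S l (traj_law S c l n) n \<omega> = mem_belief S l (traj_law S c l n) n \<omega>0"
    by (simp add: eq mem_belief_append len)
  have X: "X_at (Suc n) \<omega> = x"
    using at_snoc(1)[of \<omega>0] by (simp add: eq len)
  have ne: "set_pmf (traj_law S c l (Suc n)) \<inter> same_XZ (Suc n) \<omega> \<noteq> {}"
    using \<omega> by (auto intro: same_XZ_refl)
  have ne0: "set_pmf (traj_law S c l n) \<inter> same_XZ n \<omega>0 \<noteq> {}"
    using \<omega>0 by (auto intro: same_XZ_refl)
  have k: "pmf (next_source S n \<omega>0) x \<noteq> 0"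
    using x by (simp add: set_pmf_iff)
  have "pmf (out_mem_belief S l (traj_law S c l (Suc n)) (Suc n) \<omega>) (y', m) =
      pmf (chan S (Suc n) z) y' * pmf (mem_belief S l (traj_law S c l n) n \<omega>0) m" for y' m
  proof -
    \<comment> \<open>The vacuous conditions with \<open>UNIV\<close> give the denominator the same
      shape as the numerator, so that \<open>meas\<close> rewrites both.\<close>
    have "pmf (out_mem_belief S l (traj_law S c l (Suc n)) (Suc n) \<omega>) (y', m) =
      measure (measure_pmf (traj_law S c l (Suc n)))
        {\<omega>'. \<omega>' \<in> same_XZ (Suc n) (\<omega>0 @ [(x, z, y)]) \<and> Y_at (Suc n) \<omega>' \<in> {y'} \<and> mem S l n \<omega>' \<in> {m}} /
      measure (measure_pmf (traj_law S c l (Suc n)))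
        {\<omega>'. \<omega>' \<in> same_XZ (Suc n) (\<omega>0 @ [(x, z, y)]) \<and> Y_at (Suc n) \<omega>' \<in> UNIV \<and> mem S l n \<omega>' \<in> UNIV}"
      unfolding out_mem_belief_def pmf_map_cond_pmf[OF ne]
      by (simp add: eq[folded z_def])
    also have "\<dots> = measure (measure_pmf (traj_law S c l n)) {\<omega>' \<in> same_XZ n \<omega>0. mem S l n \<omega>' = m} /
        measure (measure_pmf (traj_law S c l n)) (same_XZ n \<omega>0) * pmf (chan S (Suc n) z) y'"
      unfolding meas using k by (simp add: pmf.rep_eq)
    also have "\<dots> = pmf (chan S (Suc n) z) y' * pmf (mem_belief S l (traj_law S c l n) n \<omega>0) m"
      by (simp add: mem_belief_def pmf_map_cond_pmf[OF ne0])
    finally show ?thesis .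
  qed
  then show ?thesis
    by (intro pmf_eqI) (auto simp: Let_def bel X pmf_pair z_def next_input_def)
qed

text \<open>Both beliefs condition on the same class, and the new memory contents are a function of
  the current output and the old contents.\<close>

lemma mem_belief_Suc:
  "mem_belief S l J (Suc n) \<omega> = map_pmf (l (Suc n)) (out_mem_belief S l J (Suc n) \<omega>)"
proof -
  have "mem S l (Suc n) = (\<lambda>\<omega>. l (Suc n) (Y_at (Suc n) \<omega>, mem S l n \<omega>))"
    by (rule ext) simp
  then show ?thesis
    by (simp add: mem_belief_def out_mem_belief_def pmf.map_comp comp_def)
qed

section \<open>Information states as discrete laws, and their kernels\<close>

definition enc_pmf :: "('x, 'z, 'y, 'm) comm_system \<Rightarrow> (nat \<Rightarrow> ('x, 'z, 'm) encoder) \<Rightarrow>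
    (nat \<Rightarrow> ('y, 'm) mem_update) \<Rightarrow> nat \<Rightarrow> ('x \<times> 'm pmf) pmf" where
  "enc_pmf S c l t = map_pmf (\<lambda>\<omega>. (X_at t \<omega>, mem_belief S l (traj_law S c l (t - 1)) (t - 1) \<omega>))
     (traj_law S c l t)"

definition mem_pmf :: "('x, 'z, 'y, 'm) comm_system \<Rightarrow> (nat \<Rightarrow> ('x, 'z, 'm) encoder) \<Rightarrow>
    (nat \<Rightarrow> ('y, 'm) mem_update) \<Rightarrow> nat \<Rightarrow> ('x \<times> ('y \<times> 'm) pmf) pmf" where
  "mem_pmf S c l t = map_pmf (\<lambda>\<omega>. (X_at t \<omega>, out_mem_belief S l (traj_law S c l t) t \<omega>))
     (traj_law S c l t)"

lemma distr_map_pmf_id: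
  "space N = UNIV \<Longrightarrow> distr (measure_pmf (map_pmf f P)) N (\<lambda>a. a) = distr (measure_pmf P) N f"
  by (simp add: map_pmf_rep_eq distr_distr comp_def)

lemma enc_info_eq: "enc_info S c l t = distr (measure_pmf (enc_pmf S c l t)) info_space (\<lambda>a. a)"
  by (simp add: enc_info_def enc_pmf_def distr_map_pmf_id space_info_space)

lemma mem_info_eq: "mem_info S c l t = distr (measure_pmf (mem_pmf S c l t)) info_space (\<lambda>a. a)"
  by (simp add: mem_info_def mem_pmf_def distr_map_pmf_id space_info_space)

definition enc_kernel :: "('x, 'z, 'y, 'm) comm_system \<Rightarrow> nat \<Rightarrow> ('x, 'z, 'm) encoder \<Rightarrow>
    'x \<times> 'm pmf \<Rightarrow> ('x \<times> ('y \<times> 'm) pmf) pmf" where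
  "enc_kernel S t f = (\<lambda>(x, p). return_pmf (x, pair_pmf (chan S t (f (x, p))) p))"

definition mem_kernel :: "('x, 'z, 'y, 'm) comm_system \<Rightarrow> nat \<Rightarrow> ('y, 'm) mem_update \<Rightarrow>
    'x \<times> ('y \<times> 'm) pmf \<Rightarrow> ('x \<times> 'm pmf) pmf" where
  "mem_kernel S t h = (\<lambda>(x, q). map_pmf (\<lambda>x'. (x', map_pmf h q)) (trans S t x))"

text \<open>By \<open>out_mem_belief_eq\<close> the second belief is a function of the current
  symbol and the first belief. That identity is available on the support of the trajectory law,
  where the conditioning events have positive probability.\<close>

lemma mem_pmf_eq:
  fixes S :: "('x::finite, 'z, 'y, 'm) comm_system"
  assumes "0 < t"
  shows "mem_pmf S c l t = bind_pmf (enc_pmf S c l t) (enc_kernel S t (c t))"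
proof -
  obtain n where t: "t = Suc n" using assms gr0_conv_Suc by auto
  have "mem_pmf S c l t = bind_pmf (traj_law S c l t)
      (\<lambda>\<omega>. return_pmf (X_at t \<omega>, out_mem_belief S l (traj_law S c l t) t \<omega>))"
    by (simp add: mem_pmf_def map_pmf_def)
  also have "\<dots> = bind_pmf (traj_law S c l t)
      (\<lambda>\<omega>. enc_kernel S t (c t) (X_at t \<omega>, mem_belief S l (traj_law S c l (t - 1)) (t - 1) \<omega>))"
    using out_mem_belief_eq[of _ S c l n]
    by (intro bind_pmf_cong refl) (simp add: t enc_kernel_def Let_def del: traj_law.simps)
  finally show ?thesis by (simp add: enc_pmf_def bind_map_pmf)
qed

text \<open>The next symbol depends on the past only through the current one, while the belief after
  stage \<open>t\<close> is already determined by the first \<open>t\<close> stages.\<close>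

lemma enc_pmf_Suc:
  assumes "0 < t"
  shows "enc_pmf S c l (Suc t) = bind_pmf (mem_pmf S c l t) (mem_kernel S t (l t))"
proof -
  obtain n where t: "t = Suc n" using assms gr0_conv_Suc by auto
  have "enc_pmf S c l (Suc t) = bind_pmf (traj_law S c l t) (\<lambda>\<omega>. bind_pmf (next_source S t \<omega>)
      (\<lambda>x. map_pmf (\<lambda>y. (X_at (Suc t) (\<omega> @ [(x, next_input S c l t \<omega> x, y)]),
         mem_belief S l (traj_law S c l t) t (\<omega> @ [(x, next_input S c l t \<omega> x, y)])))
        (chan S (Suc t) (next_input S c l t \<omega> x))))"
    by (simp add: enc_pmf_def traj_law_Suc map_bind_pmf pmf.map_comp comp_def del: traj_law.simps)
  also have "\<dots> = bind_pmf (traj_law S c l t)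
      (\<lambda>\<omega>. mem_kernel S t (l t) (X_at t \<omega>, out_mem_belief S l (traj_law S c l t) t \<omega>))"
  proof (intro bind_pmf_cong refl)
    fix \<omega> assume "\<omega> \<in> set_pmf (traj_law S c l t)"
    then have len: "length \<omega> = t" by (rule length_traj_law)
    have bel: "mem_belief S l J t (\<omega> @ v) = map_pmf (l t) (out_mem_belief S l J t \<omega>)" for J v
      by (simp add: mem_belief_append len) (simp add: t mem_belief_Suc)
    show "bind_pmf (next_source S t \<omega>)
      (\<lambda>x. map_pmf (\<lambda>y. (X_at (Suc t) (\<omega> @ [(x, next_input S c l t \<omega> x, y)]),
         mem_belief S l (traj_law S c l t) t (\<omega> @ [(x, next_input S c l t \<omega> x, y)])))
        (chan S (Suc t) (next_input S c l t \<omega> x))) =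
      mem_kernel S t (l t) (X_at t \<omega>, out_mem_belief S l (traj_law S c l t) t \<omega>)"
      \<comment> \<open>\<open>0 < t\<close> excludes the initial-law case of
        \<open>next_source\<close>. The new channel output affects neither component, so averaging
        over it is trivial.\<close>
      using assms
      by (simp add: bel at_snoc(1)[of \<omega>, unfolded len] map_pmf_const mem_kernel_def next_source_def
          del: traj_law.simps)
         (simp add: map_pmf_def)
  qed
  finally show ?thesis by (simp add: mem_pmf_def bind_map_pmf)
qed

subsection \<open>The optimal cost\<close>

text \<open>At \<open>\<phi> = mem_info S c l t\<close> with \<open>0 < t\<close> this is the joint
  probability of the source symbol \<open>x\<close> and the pair \<open>ym\<close>, expressed
  through the state alone.\<close>

definition joint_prob :: "('x \<times> ('y::finite \<times> 'm::finite) pmf) measure \<Rightarrow> 'y \<times> 'm \<Rightarrow> 'x \<Rightarrow> real" where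
  "joint_prob \<phi> ym x = (\<integral>w. indicator {x} (fst w) * pmf (snd w) ym \<partial>\<phi>)"

text \<open>Tower property: the current symbol is constant on each conditioning class, so its
  indicator moves inside the conditional probability, and averaging over the classes restores the
  unconditional one.\<close>

lemma joint_prob_mem_info:
  fixes S :: "('x::finite, 'z, 'y::finite, 'm::finite) comm_system"
  assumes "0 < t"
  shows "joint_prob (mem_info S c l t) ym x =
    measure (measure_pmf (traj_law S c l t)) {\<omega>. X_at t \<omega> = x \<and> (Y_at t \<omega>, mem S l (t - 1) \<omega>) = ym}"
proof -
  let ?J = "traj_law S c l t" and ?YM = "\<lambda>\<omega>. (Y_at t \<omega>, mem S l (t - 1) \<omega>)"
  let ?A = "{\<omega>. X_at t \<omega> = x \<and> ?YM \<omega> = ym}"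
  \<comment> \<open>Resampling a trajectory within its class preserves the law, because
    \<open>same_XZ t\<close> is an equivalence relation.\<close>
  have J: "bind_pmf ?J (\<lambda>\<omega>. cond_pmf ?J (same_XZ t \<omega>)) = ?J"
  proof -
    have *: "same_XZ t \<omega> = {\<omega>'. \<omega>' \<in> same_XZ t \<omega>}" for \<omega> :: "('x, 'z, 'y) traj" by simp
    show ?thesis
    proof (subst *, rule bind_cond_pmf_cancel)
      fix \<omega> \<omega>' :: "('x, 'z, 'y) traj" assume "\<omega>' \<in> same_XZ t \<omega>"
      then have "{\<omega>''. \<omega>' \<in> same_XZ t \<omega>''} = {\<omega>''. \<omega>'' \<in> same_XZ t \<omega>}"
        by (auto simp: same_XZ_def)
      then show "measure (measure_pmf ?J) {\<omega>''. \<omega>'' \<in> same_XZ t \<omega>} =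
          measure (measure_pmf ?J) {\<omega>''. \<omega>' \<in> same_XZ t \<omega>''}" by simp
    qed (auto intro: same_XZ_refl)
  qed
  have "joint_prob (mem_info S c l t) ym x =
      (\<integral>\<omega>. indicator {x} (X_at t \<omega>) * pmf (out_mem_belief S l ?J t \<omega>) ym \<partial>?J)"
    unfolding joint_prob_def mem_info_def
    by (subst integral_distr) (auto simp: info_space_def space_pair_measure space_simplex_borel
      intro!: measurable_compose[OF measurable_snd measurable_pmf_simplex_borel] borel_measurable_times)
  also have "\<dots> = (\<integral>\<omega>. measure (measure_pmf (cond_pmf ?J (same_XZ t \<omega>))) ?A \<partial>?J)"
  proof (intro integral_cong_AE)
    show "AE \<omega> in ?J. indicator {x} (X_at t \<omega>) * pmf (out_mem_belief S l ?J t \<omega>) ym =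
        measure (measure_pmf (cond_pmf ?J (same_XZ t \<omega>))) ?A"
    proof (subst AE_measure_pmf_iff, intro ballI)
      fix \<omega> assume "\<omega> \<in> set_pmf ?J"
      then have ne: "set_pmf ?J \<inter> same_XZ t \<omega> \<noteq> {}"
        by (auto intro: same_XZ_refl)
      \<comment> \<open>\<open>same_XZ t\<close> compares the stages from 1 to \<open>t\<close>;
        stage \<open>t\<close> is among them since \<open>0 < t\<close>.\<close>
      have X: "X_at t \<omega>' = X_at t \<omega>" if "\<omega>' \<in> set_pmf (cond_pmf ?J (same_XZ t \<omega>))" for \<omega>'
        using that ne assms by (auto simp: same_XZ_def)
      have "pmf (out_mem_belief S l ?J t \<omega>) ym = measure (measure_pmf (cond_pmf ?J (same_XZ t \<omega>))) {\<omega>'. ?YM \<omega>' = ym}"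
        by (simp add: out_mem_belief_def pmf_map vimage_def)
      then show "indicator {x} (X_at t \<omega>) * pmf (out_mem_belief S l ?J t \<omega>) ym =
          measure (measure_pmf (cond_pmf ?J (same_XZ t \<omega>))) ?A"
        using X by (auto simp: indicator_def measure_pmf_zero_iff
            intro!: measure_pmf.finite_measure_eq_AE simp: AE_measure_pmf_iff)
    qed
  qed auto
  also have "\<dots> = measure (measure_pmf ?J) ?A"
    by (simp only: measure_bind_pmf[symmetric] J)
  finally show ?thesis .
qed

text \<open>The minimisation uses unnormalised joint probabilities instead of the posterior. At a
  state reached by the system, a pair of positive probability has the same minimisers either way,
  and a null pair contributes 0.\<close>

definition min_cost :: "('x::finite \<Rightarrow> 'x \<Rightarrow> real) \<Rightarrow> ('x \<times> ('y::finite \<times> 'm::finite) pmf) measure \<Rightarrow> real" where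
  "min_cost r \<phi> = (\<Sum>ym\<in>UNIV. MIN xh. \<Sum>x\<in>UNIV. r x xh * joint_prob \<phi> ym x)"

text \<open>The expected cost splits into a sum over the pairs \<open>ym\<close>, and the decoder's
  choice at one pair affects only that summand. Multiplying the posterior cost by the nonnegative
  \<open>p ym\<close> preserves the minimality of \<open>g ym\<close>.\<close>

lemma expected_cost_optimal:
  fixes S :: "('x::finite, 'z, 'y::finite, 'm::finite) comm_system"
  assumes t: "0 < t" and g: "optimal_decoder S \<rho> c l t g"
  shows "expected_cost S \<rho> c l t g = min_cost (\<rho> t) (mem_info S c l t)"
proof -
  let ?J = "traj_law S c l t" and ?YM = "\<lambda>\<omega>. (Y_at t \<omega>, mem S l (t - 1) \<omega>)"
  define P where "P ym x = measure (measure_pmf ?J) {\<omega>. X_at t \<omega> = x \<and> ?YM \<omega> = ym}" for ym x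
  define p where "p ym = measure (measure_pmf ?J) {\<omega>. ?YM \<omega> = ym}" for ym
  \<comment> \<open>For a null pair both sides are 0, since the joint event is contained in that of
    the pair.\<close>
  have P: "P ym x = p ym * posterior S c l t ym x" for ym x
  proof (cases "p ym = 0")
    case True
    have "P ym x \<le> p ym"
      unfolding P_def p_def by (intro measure_pmf.finite_measure_mono) auto
    then show ?thesis using True measure_nonneg[of "measure_pmf ?J"] by (simp add: P_def antisym)
  qed (auto simp: posterior_def cond_prob_def P_def p_def)
  have opt: "(\<Sum>x\<in>UNIV. \<rho> t x (g ym) * P ym x) = (MIN xh. \<Sum>x\<in>UNIV. \<rho> t x xh * P ym x)" for ym
  proof (intro Min_eqI[symmetric])
    fix v assume "v \<in> range (\<lambda>xh. \<Sum>x\<in>UNIV. \<rho> t x xh * P ym x)"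
    then obtain xh where v: "v = (\<Sum>x\<in>UNIV. \<rho> t x xh * P ym x)" by auto
    have "p ym * (\<Sum>x\<in>UNIV. \<rho> t x (g ym) * posterior S c l t ym x)
        \<le> p ym * (\<Sum>x\<in>UNIV. \<rho> t x xh * posterior S c l t ym x)"
      using g[unfolded optimal_decoder_def is_arg_min_def, rule_format, of ym]
      by (intro mult_left_mono) (simp_all add: not_less p_def)
    then show "(\<Sum>x\<in>UNIV. \<rho> t x (g ym) * P ym x) \<le> v"
      by (simp add: v P sum_distrib_left mult_ac)
  qed auto
  have "expected_cost S \<rho> c l t g =
      (\<integral>w. \<rho> t (fst w) (g (snd w)) \<partial>map_pmf (\<lambda>\<omega>. (X_at t \<omega>, ?YM \<omega>)) ?J)"
    by (simp add: expected_cost_def)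
  also have "\<dots> = (\<Sum>w\<in>UNIV. \<rho> t (fst w) (g (snd w)) * pmf (map_pmf (\<lambda>\<omega>. (X_at t \<omega>, ?YM \<omega>)) ?J) w)"
    by (rule integral_measure_pmf_real) auto
  also have "\<dots> = (\<Sum>x\<in>UNIV. \<Sum>ym\<in>UNIV. \<rho> t x (g ym) * P ym x)"
    unfolding UNIV_Times_UNIV[symmetric] sum.cartesian_product
    by (intro sum.cong refl) (auto simp: pmf_map P_def vimage_def)
  also have "\<dots> = (\<Sum>ym\<in>UNIV. MIN xh. \<Sum>x\<in>UNIV. \<rho> t x xh * P ym x)"
    by (subst sum.swap) (simp only: opt)
  finally show ?thesis
    by (simp only: min_cost_def joint_prob_mem_info[OF t] P_def)
qed

theorem theorem3:
  fixes S :: "('x::finite, 'z::finite, 'y::finite, 'm::finite) comm_system"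
    and T :: nat
    and \<rho> :: "nat \<Rightarrow> 'x \<Rightarrow> 'x \<Rightarrow> real"
  assumes "\<And>t x xh. t \<in> {1..T} \<Longrightarrow> 0 \<le> \<rho> t x xh"
  shows "\<exists>(Q :: nat \<Rightarrow> ('x, 'z, 'm) encoder \<Rightarrow> ('x \<times> 'm pmf) measure \<Rightarrow> ('x \<times> ('y \<times> 'm) pmf) measure)
      (Qhat :: nat \<Rightarrow> ('y, 'm) mem_update \<Rightarrow> ('x \<times> ('y \<times> 'm) pmf) measure \<Rightarrow> ('x \<times> 'm pmf) measure)
      (\<rho>_tilde :: nat \<Rightarrow> ('x \<times> ('y \<times> 'm) pmf) measure \<Rightarrow> real).
    (\<forall>t\<in>{1..T}. \<forall>f. linear_transformation info_space info_space (Q t f)) \<and>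
    (\<forall>t\<in>{1..T}. \<forall>c l. mem_info S c l t = Q t (c t) (enc_info S c l t)) \<and>
    (\<forall>t\<in>{1..<T}. \<forall>h. linear_transformation info_space info_space (Qhat t h)) \<and>
    (\<forall>t\<in>{1..<T}. \<forall>c l. enc_info S c l (Suc t) = Qhat t (l t) (mem_info S c l t)) \<and>
    (\<forall>t\<in>{1..T}. \<forall>c l g. optimal_decoder S \<rho> c l t g \<longrightarrow>
       expected_cost S \<rho> c l t g = \<rho>_tilde t (mem_info S c l t))"
proof -
  note lin = linear_transformation_atom_kernel[OF singleton_in_info_space space_info_space]
  note push = atom_kernel_pmf[OF singleton_in_info_space space_info_space]
  \<comment> \<open>The witnesses are fixed by the displayed claims: \<open>atom_kernel\<close> of
    the two kernels, and \<open>min_cost (\<rho> t)\<close>. Each depends on the design at most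
    through the single rule passed to it.\<close>
  show ?thesis
  proof (intro exI conjI ballI allI impI)
    show "linear_transformation info_space info_space (atom_kernel info_space (enc_kernel S t f))" for t f
      by (rule lin)
    show "linear_transformation info_space info_space (atom_kernel info_space (mem_kernel S t h))" for t h
      by (rule lin)
    show "mem_info S c l t = atom_kernel info_space (enc_kernel S t (c t)) (enc_info S c l t)"
      if "t \<in> {1..T}" for t c l
      using that by (simp add: enc_info_eq mem_info_eq push mem_pmf_eq)
    show "enc_info S c l (Suc t) = atom_kernel info_space (mem_kernel S t (l t)) (mem_info S c l t)"
      if "t \<in> {1..<T}" for t c l
      using that by (simp add: enc_info_eq mem_info_eq push enc_pmf_Suc)
    show "expected_cost S \<rho> c l t g = min_cost (\<rho> t) (mem_info S c l t)"
      if "t \<in> {1..T}" "optimal_decoder S \<rho> c l t g" for t c l g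
      using that by (intro expected_cost_optimal) auto
  qed
qed

end
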